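(* Let $n\ge3$ and let $\Gamma$ be a connected graph on the vertex set $\{1,\dots,n\}$ such that (i) $\Gamma$ has $2n-3$ edges, and (ii) for any subset of $k\geq 2$ vertices, there are at most $2k-3$ edges of $\Gamma$ connecting them. Then, for generic $\sigma=(\sigma_{ij})_{\{ij\}\in\Gamma}$, the number of realizations, up to congruence, of the planar Laman linkage with graph $\Gamma$ and squared edge-lengths $\sigma$ is at most $$\frac12\binom{2n-4}{n-2}.$$
   Context: Given an assignment of non-negative real numbers $\{i,j\}\mapsto\sigma_{ij}$ to the edges of $\Gamma$, a realization is an $n$-tuple of points $p_1,\dots,p_n\in\mathbb R^2$ (at least two of them distinct) such that $|p_i-p_j|^2=\sigma_{ij}$ for all edges $\{i,j\}\in\Gamma$. Congruence means equivalence under isometries of $\mathbb R^2$ (including reflections). "Generic $\sigma$" means $\sigma$ outside some proper algebraic subset (depending on $\Gamma$) of the space of edge assignments. *)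

theory Defs
  imports "HOL-Analysis.Analysis" "HOL-Library.Poly_Mapping" "HOL-Library.Ramsey"
begin

text \<open>A simple graph on \<open>{1..n}\<close> is given by its edge set \<open>E \<subseteq> [{1..n}]\<^bsup>2\<^esup>\<close>,
  a set of two-element sets of vertices.\<close>

definition connected_graph :: "nat \<Rightarrow> nat set set \<Rightarrow> bool" where
  "connected_graph n E \<longleftrightarrow>
     (\<forall>u\<in>{1..n}. \<forall>v\<in>{1..n}. (u, v) \<in> {(i, j). {i, j} \<in> E}\<^sup>*)"

definition edge_assignments :: "nat set set \<Rightarrow> (nat set \<Rightarrow> real) set" where
  "edge_assignments E = E \<rightarrow>\<^sub>E {0..}"

text \<open>Multivariate polynomials with real coefficients are finitely supported maps from
  monomials to coefficients, and monomials are finitely supported maps from variables to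
  exponents.\<close>

type_synonym 'v real_mpoly = "('v \<Rightarrow>\<^sub>0 nat) \<Rightarrow>\<^sub>0 real"

definition mpoly_vars :: "'v real_mpoly \<Rightarrow> 'v set" where
  "mpoly_vars P = (\<Union>m\<in>Poly_Mapping.keys P. Poly_Mapping.keys m)"

definition mpoly_eval :: "'v real_mpoly \<Rightarrow> ('v \<Rightarrow> real) \<Rightarrow> real" where
  "mpoly_eval P x =
     (\<Sum>m\<in>Poly_Mapping.keys P. Poly_Mapping.lookup P m *
        (\<Prod>v\<in>Poly_Mapping.keys m. x v ^ Poly_Mapping.lookup m v))"

text \<open>Algebraic subsets are taken inside the orthant of non-negative edge assignments, so that
  properness below means that some non-negative assignment is left over.\<close>

definition algebraic_subset :: "nat set set \<Rightarrow> (nat set \<Rightarrow> real) set \<Rightarrow> bool" where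
  "algebraic_subset E Z \<longleftrightarrow>
     (\<exists>F. (\<forall>P\<in>F. mpoly_vars P \<subseteq> E) \<and>
          Z = {\<sigma> \<in> edge_assignments E. \<forall>P\<in>F. mpoly_eval P \<sigma> = 0})"

definition for_generic_assignment ::
    "nat set set \<Rightarrow> ((nat set \<Rightarrow> real) \<Rightarrow> bool) \<Rightarrow> bool" where
  "for_generic_assignment E Q \<longleftrightarrow>
     (\<exists>Z. algebraic_subset E Z \<and> Z \<subset> edge_assignments E \<and>
          (\<forall>\<sigma> \<in> edge_assignments E - Z. Q \<sigma>))"

definition configurations :: "nat \<Rightarrow> (nat \<Rightarrow> real^2) set" where
  "configurations n = {1..n} \<rightarrow>\<^sub>E UNIV"

definition realizations ::
    "nat \<Rightarrow> nat set set \<Rightarrow> (nat set \<Rightarrow> real) \<Rightarrow> (nat \<Rightarrow> real^2) set" where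
  "realizations n E \<sigma> =
     {p \<in> configurations n.
        (\<exists>i\<in>{1..n}. \<exists>j\<in>{1..n}. p i \<noteq> p j) \<and>
        (\<forall>i j. {i, j} \<in> E \<longrightarrow> (norm (p i - p j))\<^sup>2 = \<sigma> {i, j})}"

definition plane_isometry :: "(real^2 \<Rightarrow> real^2) \<Rightarrow> bool" where
  "plane_isometry f \<longleftrightarrow> bij f \<and> (\<forall>x y. dist (f x) (f y) = dist x y)"

definition congruence :: "nat \<Rightarrow> ((nat \<Rightarrow> real^2) \<times> (nat \<Rightarrow> real^2)) set" where
  "congruence n =
     {(p, q). p \<in> configurations n \<and> q \<in> configurations n \<and>
        (\<exists>f. plane_isometry f \<and> (\<forall>i\<in>{1..n}. q i = f (p i)))}"

lemma equiv_congruence: "equiv (configurations n) (congruence n)"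
proof (rule equivI)
  show "congruence n \<subseteq> configurations n \<times> configurations n"
    by (auto simp: congruence_def)
  show "refl_on (configurations n) (congruence n)"
    by (rule refl_onI) (auto simp: congruence_def plane_isometry_def intro!: exI[of _ id])
  show "sym (congruence n)"
  proof (rule symI)
    fix p q assume "(p, q) \<in> congruence n"
    then obtain f where f: "bij f" "\<And>x y. dist (f x) (f y) = dist x y"
      "\<forall>i\<in>{1..n}. q i = f (p i)" and pq: "p \<in> configurations n" "q \<in> configurations n"
      by (auto simp: congruence_def plane_isometry_def)
    have "dist (inv f x) (inv f y) = dist x y" for x y
      using f(2)[of "inv f x" "inv f y"] bij_is_surj[OF f(1)] by (simp add: surj_f_inv_f)
    moreover have "\<forall>i\<in>{1..n}. p i = inv f (q i)"
      using f(1,3) by (simp add: bij_is_inj)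
    ultimately show "(q, p) \<in> congruence n"
      using pq bij_imp_bij_inv[OF f(1)] by (auto simp: congruence_def plane_isometry_def)
  qed
  show "trans (congruence n)"
  proof (rule transI)
    fix p q r assume "(p, q) \<in> congruence n" "(q, r) \<in> congruence n"
    then obtain f g where "plane_isometry f" "plane_isometry g"
      "\<forall>i\<in>{1..n}. q i = f (p i)" "\<forall>i\<in>{1..n}. r i = g (q i)"
      and "p \<in> configurations n" "r \<in> configurations n"
      by (auto simp: congruence_def)
    moreover from this have "plane_isometry (g \<circ> f)"
      by (auto simp: plane_isometry_def intro: bij_comp)
    ultimately show "(p, r) \<in> congruence n"
      by (auto simp: congruence_def intro!: exI[of _ "g \<circ> f"])
  qed
qed

end

theory Submission imports Defs "HOL-Library.Function_Algebras" begin

text \<open>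
  Put \<open>m = n - 2\<close> and \<open>N = (2 * m choose m) div 2\<close>. The \<open>2 * m + 1\<close> squared edge lengths \<open>f e\<close>
  are functions on configurations, and realizations are points of a fibre of \<open>f\<close>. In complex
  coordinates \<open>z i\<close> relative to the first point, every squared distance is a real combination of
  functions \<open>Re (z i * cnj (z j))\<close>. The bound on a generic fibre is obtained by comparing the
  growth of two dimensions, which takes the place of an application of Bezout's theorem on a
  product of two projective spaces.

  A product of \<open>d\<close> squared distances is a combination of functions
  \<open>Re (z\<^sup>\<alpha> * cnj (z\<^sup>\<beta>))\<close> with multi-indices \<open>\<alpha>\<close> and \<open>\<beta>\<close> of degree \<open>d\<close> in \<open>m + 1\<close> variables
  (\<open>hermitian_forms_mult\<close>). Such a function is symmetric in \<open>\<alpha>\<close> and \<open>\<beta>\<close>, which reflects the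
  invariance under reflections of the plane, so the space of these functions has dimension at
  most about \<open>d ^ (2 * m) / (2 * (fact m)\<^sup>2)\<close>. On the other hand, if \<open>g\<close> is one more
  combination of squared distances, there are about \<open>(N + 1) * d ^ (2 * m) / fact (2 * m)\<close> products
  \<open>f\<^sup>\<alpha> * g ^ k\<close> of total degree \<open>d\<close> with \<open>k \<le> N\<close>. By the choice of \<open>N\<close> the second number exceeds
  the first for some \<open>d\<close> (\<open>enough_monomials\<close>), so \<open>g\<close> satisfies a nontrivial polynomial equation of
  degree at most \<open>N\<close> whose coefficients are polynomials in \<open>f\<close>
  (\<open>polynomial_relation_exists\<close>). Hence \<open>g\<close> takes at most \<open>N\<close> values on the fibre over any \<open>\<sigma>\<close>
  outside the zero set of one nonzero polynomial (\<open>generic_fibre_values_bound\<close>).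

  It remains to choose \<open>g\<close> so that its values distinguish congruence classes. Configurations
  with equal pairwise distances are congruent (\<open>congruence_if_equal_distances\<close>), so a
  combination of all squared distances with coefficients \<open>1, t, t\<^sup>2, \<dots>\<close> separates any given
  \<open>N + 1\<close> classes for all but boundedly many \<open>t\<close> (\<open>separating_combination\<close>). Finitely many values
  of \<open>t\<close> therefore suffice for all \<open>\<sigma>\<close> at once, and finitely many generic conditions hold
  simultaneously for generic \<open>\<sigma>\<close> (\<open>for_generic_assignment_finite_Ball\<close>). More than \<open>N\<close> classes
  over such a \<open>\<sigma>\<close> would give more than \<open>N\<close> values of one of the functions \<open>g\<close>.
\<close>

section \<open>Multi-indices and monomials\<close>

definition multi_indices :: "'a set \<Rightarrow> nat \<Rightarrow> ('a \<Rightarrow>\<^sub>0 nat) set" where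
  "multi_indices I d =
     {\<alpha>. Poly_Mapping.keys \<alpha> \<subseteq> I \<and> (\<Sum>i\<in>I. Poly_Mapping.lookup \<alpha> i) = d}"

lemma multi_indices_0:
  assumes "finite I"
  shows "multi_indices I 0 = {0}"
proof -
  have "\<alpha> = 0" if "\<alpha> \<in> multi_indices I 0" for \<alpha>
  proof (rule poly_mapping_eqI)
    fix i show "Poly_Mapping.lookup \<alpha> i = Poly_Mapping.lookup 0 i"
      using that assms by (cases "i \<in> I") (auto simp: multi_indices_def in_keys_iff)
  qed
  then show ?thesis by (auto simp: multi_indices_def)
qed

lemma multi_indices_empty_Suc: "multi_indices {} (Suc d) = {}"
  by (auto simp: multi_indices_def)

text \<open>Pascal's rule at the level of sets: a multi-index either avoids the variable \<open>a\<close> or is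
  obtained by raising the exponent of \<open>a\<close> by one.\<close>

lemma multi_indices_insert_Suc:
  assumes "finite I" "a \<notin> I"
  shows "multi_indices (insert a I) (Suc d) =
    multi_indices I (Suc d) \<union> (\<lambda>\<alpha>. \<alpha> + Poly_Mapping.single a 1) ` multi_indices (insert a I) d"
    (is "?L = ?R1 \<union> ?R2")
proof (rule subset_antisym; rule subsetI)
  fix \<alpha> assume \<alpha>: "\<alpha> \<in> ?L"
  show "\<alpha> \<in> ?R1 \<union> ?R2"
  proof (cases "Poly_Mapping.lookup \<alpha> a = 0")
    case True
    then have "a \<notin> Poly_Mapping.keys \<alpha>" by (simp add: in_keys_iff)
    then have "\<alpha> \<in> ?R1" using \<alpha> True assms by (auto simp: multi_indices_def)
    then show ?thesis ..
  next
    case False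
    let ?\<beta> = "\<alpha> - Poly_Mapping.single a 1"
    have eq: "\<alpha> = ?\<beta> + Poly_Mapping.single a 1"
      using False by (intro poly_mapping_eqI)
        (auto simp: lookup_add lookup_minus lookup_single when_def)
    have "Poly_Mapping.keys ?\<beta> \<subseteq> Poly_Mapping.keys \<alpha>"
      by (auto simp: in_keys_iff lookup_minus)
    then have "Poly_Mapping.keys ?\<beta> \<subseteq> insert a I"
      using \<alpha> by (auto simp: multi_indices_def)
    moreover have "(\<Sum>i\<in>insert a I. Poly_Mapping.lookup ?\<beta> i) = d"
    proof -
      have "(\<Sum>i\<in>insert a I. Poly_Mapping.lookup \<alpha> i) = Suc d"
        using \<alpha> by (auto simp: multi_indices_def)
      also have "(\<Sum>i\<in>insert a I. Poly_Mapping.lookup \<alpha> i) =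
          (\<Sum>i\<in>insert a I. Poly_Mapping.lookup ?\<beta> i) +
          (\<Sum>i\<in>insert a I. Poly_Mapping.lookup (Poly_Mapping.single a 1) i)"
      proof -
        have "Poly_Mapping.lookup \<alpha> i =
            Poly_Mapping.lookup ?\<beta> i + Poly_Mapping.lookup (Poly_Mapping.single a 1) i" for i
          by (subst eq) (simp only: lookup_add)
        then show ?thesis by (simp only: sum.distrib)
      qed
      also have "(\<Sum>i\<in>insert a I. Poly_Mapping.lookup (Poly_Mapping.single a (1::nat)) i) = 1"
        using assms by (simp add: lookup_single when_def)
      finally show ?thesis by simp
    qed
    ultimately have "?\<beta> \<in> multi_indices (insert a I) d" by (auto simp: multi_indices_def)
    then show ?thesis using eq by blast
  qed
next
  fix \<alpha> assume \<alpha>: "\<alpha> \<in> ?R1 \<union> ?R2"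
  then show "\<alpha> \<in> ?L"
  proof
    assume "\<alpha> \<in> ?R1"
    then show ?thesis using assms by (auto simp: multi_indices_def in_keys_iff)
  next
    assume "\<alpha> \<in> ?R2"
    then obtain \<beta> where \<beta>: "\<beta> \<in> multi_indices (insert a I) d" "\<alpha> = \<beta> + Poly_Mapping.single a 1"
      by blast
    have "Poly_Mapping.keys \<alpha> \<subseteq> insert a I"
      using \<beta> keys_add[of \<beta> "Poly_Mapping.single a 1"] by (auto simp: multi_indices_def)
    moreover have "(\<Sum>i\<in>insert a I. Poly_Mapping.lookup \<alpha> i) = Suc d"
    proof -
      have "(\<Sum>i\<in>insert a I. Poly_Mapping.lookup (Poly_Mapping.single a (1::nat)) i) = 1"
        using assms by (simp add: lookup_single when_def)
      then show ?thesis using \<beta> unfolding multi_indices_def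
        by (simp only: lookup_add sum.distrib mem_Collect_eq)
    qed
    ultimately show ?thesis by (auto simp: multi_indices_def)
  qed
qed

lemma finite_card_multi_indices:
  assumes "finite I"
  shows "finite (multi_indices I d) \<and> card (multi_indices I d) = (d + card I - 1) choose d"
  using assms
proof (induction I arbitrary: d rule: finite_induct)
  case empty
  show ?case by (cases d) (simp_all add: multi_indices_0 multi_indices_empty_Suc)
next
  case (insert a I)
  show ?case
  proof (induction d)
    case 0
    show ?case using insert.hyps by (simp add: multi_indices_0)
  next
    case (Suc d)
    let ?s = "\<lambda>\<alpha>. \<alpha> + Poly_Mapping.single a (1::nat)"
    have "multi_indices I (Suc d) \<inter> ?s ` multi_indices (insert a I) d = {}"
    proof -
      have "a \<notin> Poly_Mapping.keys \<alpha>" if "\<alpha> \<in> multi_indices I (Suc d)" for \<alpha>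
        using that insert.hyps by (auto simp: multi_indices_def)
      moreover have "a \<in> Poly_Mapping.keys (?s \<alpha>)" for \<alpha>
        by (simp add: in_keys_iff lookup_add)
      ultimately show ?thesis by blast
    qed
    moreover have "inj_on ?s (multi_indices (insert a I) d)"
      by (rule inj_onI) simp
    ultimately show ?case
      using Suc.IH insert.IH[of "Suc d"] insert.hyps
      by (simp add: multi_indices_insert_Suc card_Un_disjoint card_image)
  qed
qed

lemma finite_multi_indices [simp]: "finite I \<Longrightarrow> finite (multi_indices I d)"
  using finite_card_multi_indices by blast

lemma card_multi_indices:
  "finite I \<Longrightarrow> card (multi_indices I d) = (d + card I - 1) choose d"
  using finite_card_multi_indices by blast

lemma multi_indices_add:
  assumes "finite I" "\<alpha> \<in> multi_indices I c" "\<beta> \<in> multi_indices I d"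
  shows "\<alpha> + \<beta> \<in> multi_indices I (c + d)"
proof -
  have "Poly_Mapping.keys (\<alpha> + \<beta>) \<subseteq> I"
    using assms keys_add[of \<alpha> \<beta>] by (auto simp: multi_indices_def)
  then show ?thesis using assms by (simp add: multi_indices_def lookup_add sum.distrib)
qed

definition monomial_value :: "('v \<Rightarrow>\<^sub>0 nat) \<Rightarrow> ('v \<Rightarrow> 'a::comm_semiring_1) \<Rightarrow> 'a" where
  "monomial_value \<alpha> x = (\<Prod>v\<in>Poly_Mapping.keys \<alpha>. x v ^ Poly_Mapping.lookup \<alpha> v)"

lemma monomial_value_superset:
  assumes "finite V" "Poly_Mapping.keys \<alpha> \<subseteq> V"
  shows "monomial_value \<alpha> x = (\<Prod>v\<in>V. x v ^ Poly_Mapping.lookup \<alpha> v)"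
  unfolding monomial_value_def
  by (rule prod.mono_neutral_left) (use assms in \<open>auto simp: in_keys_iff\<close>)

lemma monomial_value_0 [simp]: "monomial_value 0 x = 1"
  by (simp add: monomial_value_def)

lemma monomial_value_single: "monomial_value (Poly_Mapping.single v 1) x = x v"
  by (simp add: monomial_value_def)

lemma monomial_value_add:
  "monomial_value (\<alpha> + \<beta>) x = monomial_value \<alpha> x * monomial_value \<beta> x"
proof -
  let ?V = "Poly_Mapping.keys \<alpha> \<union> Poly_Mapping.keys \<beta>"
  have "monomial_value (\<alpha> + \<beta>) x = (\<Prod>v\<in>?V. x v ^ Poly_Mapping.lookup (\<alpha> + \<beta>) v)"
    by (rule monomial_value_superset) (simp_all add: keys_add)
  also have "\<dots> = (\<Prod>v\<in>?V. x v ^ Poly_Mapping.lookup \<alpha> v) * (\<Prod>v\<in>?V. x v ^ Poly_Mapping.lookup \<beta> v)"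
    by (simp add: lookup_add power_add prod.distrib)
  also have "\<dots> = monomial_value \<alpha> x * monomial_value \<beta> x"
    by (simp add: monomial_value_superset[of ?V])
  finally show ?thesis .
qed

section \<open>Polynomials and generic assignments\<close>

lemma mpoly_eval_superset:
  assumes "finite M" "Poly_Mapping.keys P \<subseteq> M"
  shows "mpoly_eval P x = (\<Sum>\<alpha>\<in>M. Poly_Mapping.lookup P \<alpha> * monomial_value \<alpha> x)"
  unfolding mpoly_eval_def monomial_value_def
  by (rule sum.mono_neutral_left) (use assms in \<open>auto simp: in_keys_iff\<close>)

lemma mpoly_eval_add: "mpoly_eval (P + Q) x = mpoly_eval P x + mpoly_eval Q x"
proof -
  let ?M = "Poly_Mapping.keys P \<union> Poly_Mapping.keys Q"
  have "Poly_Mapping.keys (P + Q) \<subseteq> ?M" by (rule keys_add)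
  then show ?thesis
    by (simp add: mpoly_eval_superset[of ?M] lookup_add distrib_right sum.distrib)
qed

lemma mpoly_eval_single:
  "mpoly_eval (Poly_Mapping.single \<alpha> c) x = c * monomial_value \<alpha> x"
  by (subst mpoly_eval_superset[of "{\<alpha>}"]) auto

lemma mpoly_eval_0 [simp]: "mpoly_eval 0 x = 0"
  by (simp add: mpoly_eval_def)

lemma mpoly_eval_sum: "mpoly_eval (\<Sum>i\<in>S. P i) x = (\<Sum>i\<in>S. mpoly_eval (P i) x)"
  by (induction S rule: infinite_finite_induct) (auto simp: mpoly_eval_add)

lemma sum_of_terms:
  "P = (\<Sum>\<alpha>\<in>Poly_Mapping.keys P. Poly_Mapping.single \<alpha> (Poly_Mapping.lookup P \<alpha>))"
  by (rule poly_mapping_eqI) (auto simp: lookup_sum lookup_single when_def in_keys_iff)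

lemma mpoly_eval_mult: "mpoly_eval (P * Q) x = mpoly_eval P x * mpoly_eval Q x"
proof -
  have "P * Q = (\<Sum>\<alpha>\<in>Poly_Mapping.keys P. \<Sum>\<beta>\<in>Poly_Mapping.keys Q.
      Poly_Mapping.single (\<alpha> + \<beta>) (Poly_Mapping.lookup P \<alpha> * Poly_Mapping.lookup Q \<beta>))"
    by (subst (1) sum_of_terms[of P], subst (1) sum_of_terms[of Q])
      (simp add: sum_product mult_single)
  then have "mpoly_eval (P * Q) x = (\<Sum>\<alpha>\<in>Poly_Mapping.keys P. \<Sum>\<beta>\<in>Poly_Mapping.keys Q.
      (Poly_Mapping.lookup P \<alpha> * monomial_value \<alpha> x) * (Poly_Mapping.lookup Q \<beta> * monomial_value \<beta> x))"
    by (simp add: mpoly_eval_sum mpoly_eval_single monomial_value_add mult_ac)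
  then show ?thesis
    by (simp add: mpoly_eval_superset[of "Poly_Mapping.keys P" P]
        mpoly_eval_superset[of "Poly_Mapping.keys Q" Q] sum_product)
qed

lemma mpoly_vars_mult: "mpoly_vars (P * Q) \<subseteq> mpoly_vars P \<union> mpoly_vars Q"
proof
  fix v assume "v \<in> mpoly_vars (P * Q)"
  then obtain \<gamma> where "\<gamma> \<in> Poly_Mapping.keys (P * Q)" "v \<in> Poly_Mapping.keys \<gamma>"
    by (auto simp: mpoly_vars_def)
  moreover then obtain \<alpha> \<beta> where "\<gamma> = \<alpha> + \<beta>" "\<alpha> \<in> Poly_Mapping.keys P" "\<beta> \<in> Poly_Mapping.keys Q"
    using keys_mult[of P Q] by blast
  ultimately show "v \<in> mpoly_vars P \<union> mpoly_vars Q"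
    using keys_add[of \<alpha> \<beta>] by (auto simp: mpoly_vars_def)
qed

text \<open>Monomials are linearly independent as functions on the non-negative orthant. For a fixed value
  of all variables but \<open>u\<close>, the sum is a univariate polynomial in the value of \<open>u\<close> that has
  infinitely many zeros, so each of its coefficients vanishes, and those are sums of the same kind
  in fewer variables. Injectivity of the restricted exponents replaces the condition that only
  the variables in \<open>V\<close> occur, because it survives the passage to a smaller \<open>V\<close>.\<close>

lemma coeffs_eq_0_if_vanishing_on_orthant:
  fixes c :: "('v \<Rightarrow>\<^sub>0 nat) \<Rightarrow> real"
  assumes "finite V" "finite M"
    and "inj_on (\<lambda>\<alpha>. restrict (Poly_Mapping.lookup \<alpha>) V) M"
    and "\<And>x. (\<forall>v\<in>V. 0 \<le> x v) \<Longrightarrow> (\<Sum>\<alpha>\<in>M. c \<alpha> * (\<Prod>v\<in>V. x v ^ Poly_Mapping.lookup \<alpha> v)) = 0"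
    and "\<alpha> \<in> M"
  shows "c \<alpha> = 0"
  using assms
proof (induction V arbitrary: M \<alpha> rule: finite_induct)
  case empty
  then have "M = {\<alpha>}" by (auto simp: inj_on_def)
  then show ?case using empty.prems(3) by simp
next
  case (insert u V)
  let ?k = "Poly_Mapping.lookup \<alpha> u"
  let ?M = "\<lambda>k. {\<beta>\<in>M. Poly_Mapping.lookup \<beta> u = k}"
  let ?D = "(\<lambda>\<beta>. Poly_Mapping.lookup \<beta> u) ` M"
  show ?case
  proof (rule insert.IH[of "?M ?k"])
    show "finite (?M ?k)" "\<alpha> \<in> ?M ?k" using insert.prems by auto
    show "inj_on (\<lambda>\<alpha>. restrict (Poly_Mapping.lookup \<alpha>) V) (?M ?k)"
    proof (rule inj_onI)
      fix \<beta> \<gamma> assume *: "\<beta> \<in> ?M ?k" "\<gamma> \<in> ?M ?k"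
        "restrict (Poly_Mapping.lookup \<beta>) V = restrict (Poly_Mapping.lookup \<gamma>) V"
      have "Poly_Mapping.lookup \<beta> v = Poly_Mapping.lookup \<gamma> v" if "v \<in> insert u V" for v
      proof (cases "v = u")
        case True then show ?thesis using * by simp
      next
        case False
        then show ?thesis using that fun_cong[OF *(3), of v] by simp
      qed
      then have "restrict (Poly_Mapping.lookup \<beta>) (insert u V) = restrict (Poly_Mapping.lookup \<gamma>) (insert u V)"
        by (intro restrict_ext)
      then show "\<beta> = \<gamma>" using * by (intro inj_onD[OF insert.prems(2)]) auto
    qed
    fix x :: "'v \<Rightarrow> real" assume x: "\<forall>v\<in>V. 0 \<le> x v"
    let ?a = "\<lambda>k. \<Sum>\<beta>\<in>?M k. c \<beta> * (\<Prod>v\<in>V. x v ^ Poly_Mapping.lookup \<beta> v)"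
    let ?p = "\<Sum>k\<in>?D. monom (?a k) k"
    have fin: "finite ?D" using insert.prems by simp
    have "poly ?p s = 0" if "s \<ge> 0" for s
    proof -
      have "0 = (\<Sum>\<beta>\<in>M. c \<beta> * (\<Prod>v\<in>insert u V. (x(u := s)) v ^ Poly_Mapping.lookup \<beta> v))"
        using insert.prems(3)[of "x(u := s)"] x that by simp
      also have "\<dots> = (\<Sum>\<beta>\<in>M. c \<beta> * (\<Prod>v\<in>V. x v ^ Poly_Mapping.lookup \<beta> v) * s ^ Poly_Mapping.lookup \<beta> u)"
      proof (rule sum.cong[OF refl])
        fix \<beta>
        have "(\<Prod>v\<in>V. (x(u := s)) v ^ Poly_Mapping.lookup \<beta> v) = (\<Prod>v\<in>V. x v ^ Poly_Mapping.lookup \<beta> v)"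
          by (rule prod.cong) (use insert.hyps in auto)
        then show "c \<beta> * (\<Prod>v\<in>insert u V. (x(u := s)) v ^ Poly_Mapping.lookup \<beta> v) =
            c \<beta> * (\<Prod>v\<in>V. x v ^ Poly_Mapping.lookup \<beta> v) * s ^ Poly_Mapping.lookup \<beta> u"
          using insert.hyps by simp
      qed
      also have "\<dots> = (\<Sum>k\<in>?D. \<Sum>\<beta>\<in>?M k.
          c \<beta> * (\<Prod>v\<in>V. x v ^ Poly_Mapping.lookup \<beta> v) * s ^ Poly_Mapping.lookup \<beta> u)"
        by (rule sum.image_gen[OF insert.prems(1)])
      also have "\<dots> = (\<Sum>k\<in>?D. ?a k * s ^ k)"
        by (rule sum.cong) (auto simp: sum_distrib_right)
      finally show ?thesis by (simp add: poly_sum poly_monom)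
    qed
    then have "{0..} \<subseteq> {s. poly ?p s = 0}" by auto
    moreover have "infinite {0::real..}" by (rule infinite_Ici)
    ultimately have "?p = 0" using poly_roots_finite finite_subset by blast
    then have "coeff ?p ?k = 0" by simp
    then show "?a ?k = 0" using fin insert.prems(4) by (simp add: coeff_sum)
  qed
qed

lemma mpoly_nonzero_on_orthant:
  assumes "finite V" "mpoly_vars P \<subseteq> V" "P \<noteq> 0"
  shows "\<exists>x\<in>V \<rightarrow>\<^sub>E {0..}. mpoly_eval P x \<noteq> 0"
proof (rule ccontr)
  assume "\<not> ?thesis"
  then have zero: "mpoly_eval P x = 0" if "x \<in> V \<rightarrow>\<^sub>E {0..}" for x using that by blast
  have keys: "Poly_Mapping.keys \<alpha> \<subseteq> V" if "\<alpha> \<in> Poly_Mapping.keys P" for \<alpha>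
    using that assms(2) by (auto simp: mpoly_vars_def)
  from assms(3) obtain \<alpha> where \<alpha>: "\<alpha> \<in> Poly_Mapping.keys P" by fastforce
  have "Poly_Mapping.lookup P \<alpha> = 0"
  proof (rule coeffs_eq_0_if_vanishing_on_orthant[OF assms(1) finite_keys[of P] _ _ \<alpha>])
    show "inj_on (\<lambda>\<alpha>. restrict (Poly_Mapping.lookup \<alpha>) V) (Poly_Mapping.keys P)"
    proof (rule inj_onI, rule poly_mapping_eqI)
      fix \<beta> \<gamma> v assume *: "\<beta> \<in> Poly_Mapping.keys P" "\<gamma> \<in> Poly_Mapping.keys P"
        "restrict (Poly_Mapping.lookup \<beta>) V = restrict (Poly_Mapping.lookup \<gamma>) V"
      show "Poly_Mapping.lookup \<beta> v = Poly_Mapping.lookup \<gamma> v"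
      proof (cases "v \<in> V")
        case True then show ?thesis using fun_cong[OF *(3), of v] by simp
      next
        case False
        then have "v \<notin> Poly_Mapping.keys \<beta>" "v \<notin> Poly_Mapping.keys \<gamma>" using keys * by blast+
        then show ?thesis by (simp add: in_keys_iff)
      qed
    qed
    fix x :: "'a \<Rightarrow> real" assume "\<forall>v\<in>V. 0 \<le> x v"
    then have "0 = mpoly_eval P (restrict x V)" by (intro zero[symmetric]) auto
    also have "\<dots> = (\<Sum>\<beta>\<in>Poly_Mapping.keys P. Poly_Mapping.lookup P \<beta> *
        (\<Prod>v\<in>V. x v ^ Poly_Mapping.lookup \<beta> v))"
      unfolding mpoly_eval_superset[OF finite_keys[of P] order_refl]
      by (rule sum.cong) (simp_all add: monomial_value_superset[OF assms(1) keys])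
    finally show "(\<Sum>\<beta>\<in>Poly_Mapping.keys P. Poly_Mapping.lookup P \<beta> *
        (\<Prod>v\<in>V. x v ^ Poly_Mapping.lookup \<beta> v)) = 0" by simp
  qed
  then show False using \<alpha> by (simp add: in_keys_iff)
qed

lemma for_generic_assignment_nonvanishing:
  assumes "finite E" "mpoly_vars P \<subseteq> E" "P \<noteq> 0"
  shows "for_generic_assignment E (\<lambda>\<sigma>. mpoly_eval P \<sigma> \<noteq> 0)"
  unfolding for_generic_assignment_def algebraic_subset_def
proof (intro exI conjI)
  let ?Z = "{\<sigma> \<in> edge_assignments E. \<forall>P\<in>{P}. mpoly_eval P \<sigma> = 0}"
  show "\<forall>P\<in>{P}. mpoly_vars P \<subseteq> E" using assms by simp
  show "?Z = ?Z" ..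
  show "?Z \<subset> edge_assignments E"
    using mpoly_nonzero_on_orthant[OF assms] by (auto simp: edge_assignments_def)
  show "\<forall>\<sigma>\<in>edge_assignments E - ?Z. mpoly_eval P \<sigma> \<noteq> 0" by auto
qed

lemma for_generic_assignment_mono:
  assumes "for_generic_assignment E Q"
    and "\<And>\<sigma>. \<sigma> \<in> edge_assignments E \<Longrightarrow> Q \<sigma> \<Longrightarrow> R \<sigma>"
  shows "for_generic_assignment E R"
  using assms unfolding for_generic_assignment_def by blast

lemma mpoly_eval_on_line:
  "\<exists>p. \<forall>t. mpoly_eval P (\<lambda>v. a v + t * b v) = poly p t"
proof (intro exI allI)
  fix t
  show "mpoly_eval P (\<lambda>v. a v + t * b v) =
      poly (\<Sum>\<alpha>\<in>Poly_Mapping.keys P. smult (Poly_Mapping.lookup P \<alpha>)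
        (\<Prod>v\<in>Poly_Mapping.keys \<alpha>. [:a v, b v:] ^ Poly_Mapping.lookup \<alpha> v)) t"
    by (simp add: mpoly_eval_def poly_sum poly_prod)
qed

lemma mpoly_eval_cong:
  assumes "mpoly_vars P \<subseteq> V" "\<And>v. v \<in> V \<Longrightarrow> x v = y v"
  shows "mpoly_eval P x = mpoly_eval P y"
  unfolding mpoly_eval_def using assms
  by (intro sum.cong refl arg_cong2[where f = "(*)"] prod.cong) (auto simp: mpoly_vars_def)

text \<open>The orthant is irreducible: on the segment from \<open>\<sigma>\<close> to \<open>\<tau>\<close>, which stays in the orthant by
  convexity, both polynomials restrict to nonzero univariate polynomials, whose finitely many
  zeros do not fill the segment.\<close>

lemma common_nonvanishing_point:
  assumes P: "mpoly_vars P \<subseteq> E" "\<sigma> \<in> edge_assignments E" "mpoly_eval P \<sigma> \<noteq> 0"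
    and Q: "mpoly_vars Q \<subseteq> E" "\<tau> \<in> edge_assignments E" "mpoly_eval Q \<tau> \<noteq> 0"
  shows "\<exists>\<upsilon>\<in>edge_assignments E. mpoly_eval P \<upsilon> \<noteq> 0 \<and> mpoly_eval Q \<upsilon> \<noteq> 0"
proof -
  let ?l = "\<lambda>t v. \<sigma> v + t * (\<tau> v - \<sigma> v)"
  obtain p where p: "mpoly_eval P (?l t) = poly p t" for t
    using mpoly_eval_on_line[of P \<sigma> "\<lambda>v. \<tau> v - \<sigma> v"] by blast
  obtain q where q: "mpoly_eval Q (?l t) = poly q t" for t
    using mpoly_eval_on_line[of Q \<sigma> "\<lambda>v. \<tau> v - \<sigma> v"] by blast
  have "poly p 0 \<noteq> 0" "poly q 1 \<noteq> 0"
    using p[of 0] q[of 1] P Q by simp_all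
  then have "p \<noteq> 0" "q \<noteq> 0" by auto
  then have "finite {t. poly (p * q) t = 0}" by (intro poly_roots_finite) simp
  moreover have "infinite {0..1::real}" by (simp add: infinite_Icc)
  ultimately obtain t where t: "t \<in> {0..1}" "poly (p * q) t \<noteq> 0"
    by (metis (mono_tags, lifting) finite_subset mem_Collect_eq subsetI)
  let ?u = "restrict (?l t) E"
  have "0 \<le> ?l t v" if "v \<in> E" for v
  proof -
    have "0 \<le> \<sigma> v" "0 \<le> \<tau> v" using that P(2) Q(2) by (auto simp: edge_assignments_def)
    then have "0 \<le> (1 - t) * \<sigma> v + t * \<tau> v" using t by simp
    then show ?thesis by (simp add: algebra_simps)
  qed
  then have "?u \<in> edge_assignments E" by (auto simp: edge_assignments_def)
  moreover have "mpoly_eval P ?u = poly p t"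
    unfolding p[symmetric] by (rule mpoly_eval_cong[OF P(1)]) simp
  moreover have "mpoly_eval Q ?u = poly q t"
    unfolding q[symmetric] by (rule mpoly_eval_cong[OF Q(1)]) simp
  ultimately show ?thesis using t by (auto intro!: bexI[of _ ?u])
qed

text \<open>The union of two algebraic sets is cut out by the pairwise products of their equations.\<close>

lemma for_generic_assignment_conj:
  assumes "for_generic_assignment E Q" "for_generic_assignment E R"
  shows "for_generic_assignment E (\<lambda>\<sigma>. Q \<sigma> \<and> R \<sigma>)"
proof -
  obtain F where F: "\<forall>P\<in>F. mpoly_vars P \<subseteq> E"
      "{\<sigma> \<in> edge_assignments E. \<forall>P\<in>F. mpoly_eval P \<sigma> = 0} \<subset> edge_assignments E"
      "\<forall>\<sigma> \<in> edge_assignments E - {\<sigma> \<in> edge_assignments E. \<forall>P\<in>F. mpoly_eval P \<sigma> = 0}. Q \<sigma>"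
    using assms(1) unfolding for_generic_assignment_def algebraic_subset_def by blast
  obtain G where G: "\<forall>P\<in>G. mpoly_vars P \<subseteq> E"
      "{\<sigma> \<in> edge_assignments E. \<forall>P\<in>G. mpoly_eval P \<sigma> = 0} \<subset> edge_assignments E"
      "\<forall>\<sigma> \<in> edge_assignments E - {\<sigma> \<in> edge_assignments E. \<forall>P\<in>G. mpoly_eval P \<sigma> = 0}. R \<sigma>"
    using assms(2) unfolding for_generic_assignment_def algebraic_subset_def by blast
  let ?H = "(\<lambda>(P, P'). P * P') ` (F \<times> G)"
  let ?Z = "{\<sigma> \<in> edge_assignments E. \<forall>P\<in>?H. mpoly_eval P \<sigma> = 0}"
  have nz: "\<sigma> \<notin> ?Z" if "P \<in> F" "P' \<in> G" "mpoly_eval P \<sigma> \<noteq> 0" "mpoly_eval P' \<sigma> \<noteq> 0" for \<sigma> P P'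
    using that by (force simp: mpoly_eval_mult)
  have "algebraic_subset E ?Z"
    unfolding algebraic_subset_def
    using F(1) G(1) mpoly_vars_mult by (intro exI[of _ ?H]) fastforce
  moreover have "?Z \<subset> edge_assignments E"
  proof -
    obtain \<sigma> P where 1: "\<sigma> \<in> edge_assignments E" "P \<in> F" "mpoly_eval P \<sigma> \<noteq> 0" using F(2) by blast
    obtain \<tau> P' where 2: "\<tau> \<in> edge_assignments E" "P' \<in> G" "mpoly_eval P' \<tau> \<noteq> 0" using G(2) by blast
    obtain \<upsilon> where "\<upsilon> \<in> edge_assignments E" "mpoly_eval P \<upsilon> \<noteq> 0" "mpoly_eval P' \<upsilon> \<noteq> 0"
      using common_nonvanishing_point[of P E \<sigma> P' \<tau>] 1 2 F(1) G(1) by blast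
    then show ?thesis using nz[of P P' \<upsilon>] 1 2 by blast
  qed
  moreover have "Q \<sigma> \<and> R \<sigma>" if "\<sigma> \<in> edge_assignments E - ?Z" for \<sigma>
  proof -
    from that have \<sigma>: "\<sigma> \<in> edge_assignments E"
      and "\<exists>PP\<in>F \<times> G. mpoly_eval (fst PP * snd PP) \<sigma> \<noteq> 0" by force+
    then obtain P P' where "P \<in> F" "P' \<in> G" "mpoly_eval P \<sigma> \<noteq> 0" "mpoly_eval P' \<sigma> \<noteq> 0"
      by (auto simp: mpoly_eval_mult)
    then show ?thesis using F(3) G(3) \<sigma> by blast
  qed
  ultimately show ?thesis unfolding for_generic_assignment_def by blast
qed

text \<open>Finiteness of \<open>T\<close> is essential: an infinite union of proper algebraic subsets may be
  everything. This is why only finitely many test functions are used below.\<close>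

lemma for_generic_assignment_finite_Ball:
  assumes "finite T" "\<And>t. t \<in> T \<Longrightarrow> for_generic_assignment E (Q t)"
  shows "for_generic_assignment E (\<lambda>\<sigma>. \<forall>t\<in>T. Q t \<sigma>)"
  using assms
proof (induction T rule: finite_induct)
  case empty
  have "(\<lambda>v\<in>E. 0) \<in> edge_assignments E" by (auto simp: edge_assignments_def)
  moreover have "mpoly_eval 1 \<sigma> = 1" for \<sigma> :: "nat set \<Rightarrow> real"
    unfolding single_one[symmetric] mpoly_eval_single by simp
  moreover have "mpoly_vars (1 :: nat set real_mpoly) = {}"
    unfolding single_one[symmetric] by (simp add: mpoly_vars_def)
  ultimately show ?case
    unfolding for_generic_assignment_def algebraic_subset_def
    by (intro exI[of _ "{}"]) (auto intro!: exI[of _ "{1}"])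
next
  case (insert t T)
  then show ?case using for_generic_assignment_conj[of E "Q t" "\<lambda>\<sigma>. \<forall>t\<in>T. Q t \<sigma>"] by simp
qed

section \<open>Symmetric bihomogeneous forms in the complex coordinates\<close>

text \<open>Arbitrary real-valued functions form a vector space, and the dimension count below takes place
  in it.\<close>

interpretation real_fun: vector_space "\<lambda>(c::real) (f :: 'a \<Rightarrow> real). (\<lambda>x. c * f x)"
  by unfold_locales (auto simp: fun_eq_iff algebra_simps)

lemma sum_fun_apply: "(\<Sum>i\<in>I. f i) x = (\<Sum>i\<in>I. f i x)"
  by (induction I rule: infinite_finite_induct) auto

text \<open>The functions are indexed and may coincide, in which case two equal members already give a
  relation. This matters because a product of forms can be written in several ways.\<close>

lemma linear_relation_exists:
  fixes f :: "'i \<Rightarrow> 'x \<Rightarrow> real"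
  assumes "finite S" "finite I" "card S < card I" "\<And>i. i \<in> I \<Longrightarrow> f i \<in> real_fun.span S"
  shows "\<exists>c. (\<exists>i\<in>I. c i \<noteq> 0) \<and> (\<forall>x. (\<Sum>i\<in>I. c i * f i x) = 0)"
proof (cases "inj_on f I")
  case True
  then have "card (f ` I) = card I" by (rule card_image)
  then have "real_fun.dependent (f ` I)"
    using real_fun.independent_span_bound[of S "f ` I"] assms by fastforce
  then obtain u where u: "\<exists>v\<in>f ` I. u v \<noteq> 0" "(\<Sum>v\<in>f ` I. (\<lambda>x. u v * v x)) = 0"
    using real_fun.dependent_finite[of "f ` I"] assms(2) by auto
  have "(\<Sum>i\<in>I. u (f i) * f i x) = 0" for x
  proof -
    have "(\<Sum>i\<in>I. u (f i) * f i x) = (\<Sum>v\<in>f ` I. u v * v x)"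
      using sum.reindex[OF True, of "\<lambda>v. u v * v x"] by simp
    also have "\<dots> = (\<Sum>v\<in>f ` I. (\<lambda>x. u v * v x)) x" by (simp only: sum_fun_apply)
    finally show ?thesis using u by simp
  qed
  then show ?thesis using u by (intro exI[of _ "u \<circ> f"]) auto
next
  case False
  then obtain i j where ij: "i \<in> I" "j \<in> I" "i \<noteq> j" "f i = f j" by (auto simp: inj_on_def)
  let ?c = "\<lambda>k. if k = i then 1 else if k = j then -1 else (0::real)"
  have "(\<Sum>k\<in>I. ?c k * f k x) = 0" for x
  proof -
    have "(\<Sum>k\<in>I. ?c k * f k x) = (\<Sum>k\<in>{i,j}. ?c k * f k x)"
      by (rule sum.mono_neutral_right) (use assms(2) ij in auto)
    then show ?thesis using ij by simp
  qed
  then show ?thesis using ij by (intro exI[of _ ?c]) auto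
qed

text \<open>This is where the factor \<open>1/2\<close> of the final bound comes from: a symmetric function takes at most
  one value per unordered pair.\<close>

lemma card_image_symmetric:
  assumes "finite A" "\<And>x y. f x y = f y x"
  shows "card {f x y |x y. x \<in> A \<and> y \<in> A} \<le> (card A * (card A + 1)) div 2"
  using assms(1)
proof (induction A rule: finite_induct)
  case empty
  then show ?case by simp
next
  case (insert a A)
  let ?S = "{f x y |x y. x \<in> A \<and> y \<in> A}"
  have "?S = (\<lambda>(x, y). f x y) ` (A \<times> A)" by auto
  then have fin: "finite ?S" using insert.hyps by simp
  have "{f x y |x y. x \<in> insert a A \<and> y \<in> insert a A} \<subseteq> ?S \<union> f a ` insert a A"
    using assms(2) by auto
  then have "card {f x y |x y. x \<in> insert a A \<and> y \<in> insert a A} \<le> card (?S \<union> f a ` insert a A)"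
    using fin insert.hyps by (intro card_mono) auto
  also have "\<dots> \<le> card ?S + card (f a ` insert a A)" by (rule card_Un_le)
  also have "\<dots> \<le> (card A * (card A + 1)) div 2 + (card A + 1)"
    using insert.IH card_image_le[of "insert a A" "f a"] insert.hyps by simp
  also have "\<dots> = (card (insert a A) * (card (insert a A) + 1)) div 2"
    using insert.hyps by simp
  finally show ?case .
qed

text \<open>With \<open>w = cnj z\<close> these are the symmetrized monomials of bidegree \<open>(d, d)\<close> in \<open>(z, w)\<close>. They are
  invariant under a common rotation of all coordinates, because the bidegree is balanced, and
  under complex conjugation, because of the real part.\<close>

definition hermitian_monomials ::
    "('x \<Rightarrow> 'v \<Rightarrow> complex) \<Rightarrow> 'v set \<Rightarrow> nat \<Rightarrow> ('x \<Rightarrow> real) set" where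
  "hermitian_monomials z V d =
     {\<lambda>x. Re (monomial_value \<alpha> (z x) * cnj (monomial_value \<beta> (z x))) |\<alpha> \<beta>.
        \<alpha> \<in> multi_indices V d \<and> \<beta> \<in> multi_indices V d}"

abbreviation hermitian_forms ::
    "('x \<Rightarrow> 'v \<Rightarrow> complex) \<Rightarrow> 'v set \<Rightarrow> nat \<Rightarrow> ('x \<Rightarrow> real) set" where
  "hermitian_forms z V d \<equiv> real_fun.span (hermitian_monomials z V d)"

lemma finite_hermitian_monomials:
  assumes "finite V"
  shows "finite (hermitian_monomials z V d)"
proof -
  have "hermitian_monomials z V d =
      (\<lambda>(\<alpha>, \<beta>) x. Re (monomial_value \<alpha> (z x) * cnj (monomial_value \<beta> (z x)))) `
        (multi_indices V d \<times> multi_indices V d)"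
    by (force simp: hermitian_monomials_def)
  then show ?thesis using assms by simp
qed

lemma card_hermitian_monomials:
  assumes "finite V" "A = (d + card V - 1) choose d"
  shows "card (hermitian_monomials z V d) \<le> (A * (A + 1)) div 2"
proof -
  let ?h = "\<lambda>\<alpha> \<beta> x. Re (monomial_value \<alpha> (z x) * cnj (monomial_value \<beta> (z x)))"
  have "?h \<alpha> \<beta> = ?h \<beta> \<alpha>" for \<alpha> \<beta> by (simp add: fun_eq_iff)
  then have "card {?h \<alpha> \<beta> |\<alpha> \<beta>. \<alpha> \<in> multi_indices V d \<and> \<beta> \<in> multi_indices V d} \<le>
      (card (multi_indices V d) * (card (multi_indices V d) + 1)) div 2"
    by (intro card_image_symmetric) (use assms(1) in auto)
  then show ?thesis
    unfolding hermitian_monomials_def card_multi_indices[OF assms(1)] assms(2) .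
qed

text \<open>The identity \<open>Re u * Re v = (Re (u * v) + Re (cnj u * v)) / 2\<close> writes the product as a
  combination of two monomials. In the second one, conjugation exchanges the roles of \<open>\<alpha>\<close> and
  \<open>\<beta>\<close>, which is harmless because both have the same degree.\<close>

lemma hermitian_monomials_mult:
  assumes "finite V" "f \<in> hermitian_monomials z V c" "h \<in> hermitian_monomials z V d"
  shows "(\<lambda>x. f x * h x) \<in> hermitian_forms z V (c + d)"
proof -
  let ?m = "\<lambda>\<alpha> x. monomial_value \<alpha> (z x)"
  obtain \<alpha> \<beta> where f: "f = (\<lambda>x. Re (?m \<alpha> x * cnj (?m \<beta> x)))"
    "\<alpha> \<in> multi_indices V c" "\<beta> \<in> multi_indices V c"
    using assms(2) by (auto simp: hermitian_monomials_def)
  obtain \<gamma> \<delta> where h: "h = (\<lambda>x. Re (?m \<gamma> x * cnj (?m \<delta> x)))"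
    "\<gamma> \<in> multi_indices V d" "\<delta> \<in> multi_indices V d"
    using assms(3) by (auto simp: hermitian_monomials_def)
  let ?p = "\<lambda>x. Re (?m (\<alpha> + \<gamma>) x * cnj (?m (\<beta> + \<delta>) x))"
  let ?q = "\<lambda>x. Re (?m (\<beta> + \<gamma>) x * cnj (?m (\<alpha> + \<delta>) x))"
  have "?p \<in> hermitian_forms z V (c + d)" "?q \<in> hermitian_forms z V (c + d)"
    using f h assms(1)
    by (auto simp: hermitian_monomials_def intro!: real_fun.span_base multi_indices_add)
  then have "(\<lambda>x. (1/2) * ?p x) + (\<lambda>x. (1/2) * ?q x) \<in> hermitian_forms z V (c + d)"
    by (intro real_fun.span_add real_fun.span_scale)
  also have "(\<lambda>x. (1/2) * ?p x) + (\<lambda>x. (1/2) * ?q x) = (\<lambda>x. f x * h x)"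
    by (simp add: fun_eq_iff f(1) h(1) monomial_value_add algebra_simps)
  finally show ?thesis .
qed

lemma hermitian_forms_mult:
  assumes "finite V" "f \<in> hermitian_forms z V c" "h \<in> hermitian_forms z V d"
  shows "(\<lambda>x. f x * h x) \<in> hermitian_forms z V (c + d)"
proof -
  have 1: "(\<lambda>x. f x * h x) \<in> hermitian_forms z V (c + d)"
    if "f \<in> hermitian_monomials z V c" for f
    using assms(3)
  proof (induction rule: real_fun.span_induct_alt)
    case base
    show ?case using real_fun.span_zero by (simp add: zero_fun_def)
  next
    case (step a h k)
    have "(\<lambda>x. a * (f x * h x)) + (\<lambda>x. f x * k x) \<in> hermitian_forms z V (c + d)"
      by (intro real_fun.span_add real_fun.span_scale step hermitian_monomials_mult assms that)
    then show ?case by (simp add: plus_fun_def algebra_simps)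
  qed
  show ?thesis
    using assms(2)
  proof (induction rule: real_fun.span_induct_alt)
    case base
    show ?case using real_fun.span_zero by (simp add: zero_fun_def)
  next
    case (step a f k)
    have "(\<lambda>x. a * (f x * h x)) + (\<lambda>x. k x * h x) \<in> hermitian_forms z V (c + d)"
      by (intro real_fun.span_add real_fun.span_scale step 1)
    then show ?case by (simp add: plus_fun_def algebra_simps)
  qed
qed

lemma hermitian_forms_1:
  assumes "finite V"
  shows "(\<lambda>x. 1) \<in> hermitian_forms z V 0"
  using assms by (intro real_fun.span_base) (simp add: hermitian_monomials_def multi_indices_0)

lemma hermitian_forms_power:
  assumes "finite V" "f \<in> hermitian_forms z V c"
  shows "(\<lambda>x. f x ^ k) \<in> hermitian_forms z V (c * k)"
proof (induction k)
  case 0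
  then show ?case using hermitian_forms_1[OF assms(1)] by simp
next
  case (Suc k)
  then show ?case using hermitian_forms_mult[OF assms(1,2) Suc] by simp
qed

lemma hermitian_forms_prod:
  assumes "finite V" "finite E" "\<And>e. e \<in> E \<Longrightarrow> f e \<in> hermitian_forms z V (c e)"
  shows "(\<lambda>x. \<Prod>e\<in>E. f e x) \<in> hermitian_forms z V (\<Sum>e\<in>E. c e)"
  using assms(2,3)
proof (induction E rule: finite_induct)
  case empty
  then show ?case using hermitian_forms_1[OF assms(1)] by simp
next
  case (insert e E)
  then show ?case using hermitian_forms_mult[OF assms(1), of "f e" z "c e"] by simp
qed

lemma hermitian_forms_monomial_value:
  assumes "finite V" "finite E" "\<And>e. e \<in> E \<Longrightarrow> f e \<in> hermitian_forms z V 1"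
    and "\<alpha> \<in> multi_indices E d"
  shows "(\<lambda>x. monomial_value \<alpha> (\<lambda>e. f e x)) \<in> hermitian_forms z V d"
proof -
  have "(\<lambda>x. \<Prod>e\<in>E. f e x ^ Poly_Mapping.lookup \<alpha> e) \<in>
      hermitian_forms z V (\<Sum>e\<in>E. 1 * Poly_Mapping.lookup \<alpha> e)"
    by (intro hermitian_forms_prod hermitian_forms_power assms)
  then show ?thesis
    using assms(4) by (simp add: multi_indices_def monomial_value_superset[OF assms(2)])
qed

section \<open>Asymptotic comparison of the two dimensions\<close>

lemma tendsto_shifted_ratio: "(\<lambda>d. (real d + a) / real d) \<longlonglongrightarrow> 1"
proof -
  have "(\<lambda>d. 1 + a * inverse (real d)) \<longlonglongrightarrow> 1 + a * 0"
    by (intro tendsto_intros lim_inverse_n)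
  moreover have "\<forall>\<^sub>F d in sequentially. 1 + a * inverse (real d) = (real d + a) / real d"
    using eventually_gt_at_top[of 0] by eventually_elim (simp add: field_simps)
  ultimately show ?thesis by (auto intro: Lim_transform_eventually)
qed

lemma tendsto_binomial_over_power:
  "(\<lambda>d. real ((d + c) choose c) / real d ^ c) \<longlonglongrightarrow> 1 / fact c"
proof (induction c)
  case 0
  show ?case by simp
next
  case (Suc c)
  have "(\<lambda>d. (real (d + Suc c) / real d) / real (Suc c)) \<longlonglongrightarrow> 1 / real (Suc c)"
  proof (intro tendsto_divide tendsto_const)
    show "(\<lambda>d. real (d + Suc c) / real d) \<longlonglongrightarrow> 1"
      using tendsto_shifted_ratio[of "real (Suc c)"] by (simp only: of_nat_add)
  qed simp
  from tendsto_mult[OF Suc this]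
  have "(\<lambda>d. real ((d + c) choose c) / real d ^ c * ((real (d + Suc c) / real d) / real (Suc c)))
      \<longlonglongrightarrow> 1 / fact c * (1 / real (Suc c))" .
  also have "(\<lambda>d. real ((d + c) choose c) / real d ^ c * ((real (d + Suc c) / real d) / real (Suc c)))
      = (\<lambda>d. real ((d + Suc c) choose Suc c) / real d ^ Suc c)"
  proof
    fix d
    have "real (Suc c) * real ((d + Suc c) choose Suc c) = real (d + Suc c) * real ((d + c) choose c)"
      using Suc_times_binomial[of c "d + c"] by (simp only: of_nat_mult[symmetric] add_Suc_right)
    then have "real ((d + Suc c) choose Suc c) = real (d + Suc c) * real ((d + c) choose c) / real (Suc c)"
      by (simp add: field_simps)
    then show "real ((d + c) choose c) / real d ^ c * ((real (d + Suc c) / real d) / real (Suc c))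
      = real ((d + Suc c) choose Suc c) / real d ^ Suc c"
      by (simp only: power_Suc times_divide_eq_left times_divide_eq_right divide_divide_eq_left mult_ac)
  qed
  also have "1 / fact c * (1 / real (Suc c)) = 1 / fact (Suc c)"
    by (simp add: mult.commute)
  finally show ?case .
qed

text \<open>After division by \<open>d ^ (2 * m)\<close> the left side tends to \<open>1 / (2 * (fact m)\<^sup>2)\<close> and the right
  side to \<open>(N + 1) / fact (2 * m)\<close>. The second limit is larger exactly when
  \<open>N + 1 > (2 * m choose m) / 2\<close>, so \<open>N\<close> is the best value that this comparison allows. The
  hypothesis on \<open>m\<close> makes the linear term of \<open>A * (A + 1)\<close>, with \<open>A = (d + m) choose m\<close>,
  of lower order.\<close>

lemma enough_monomials:
  assumes "m \<ge> 1"
  defines "N \<equiv> (2 * m choose m) div 2"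
  shows "\<exists>d\<ge>N. (((d + m) choose m) * (((d + m) choose m) + 1)) div 2 <
    (\<Sum>k\<le>N. (d - k + 2 * m) choose (2 * m))"
proof -
  let ?A = "\<lambda>d. real ((d + m) choose m)"
  note X = tendsto_binomial_over_power[of m]
  have "(\<lambda>d. ?A d / real d ^ m * ((?A d / real d ^ m + inverse (real d) ^ m) / 2))
      \<longlonglongrightarrow> 1 / fact m * ((1 / fact m + 0 ^ m) / 2)"
    by (rule tendsto_mult[OF X tendsto_divide[OF tendsto_add[OF X tendsto_power[OF lim_inverse_n]]
            tendsto_const]]) simp
  moreover have "?A d / real d ^ m * ((?A d / real d ^ m + inverse (real d) ^ m) / 2) =
      (?A d * (?A d + 1) / 2) / real d ^ (2 * m)" for d
  proof -
    have "a / y * ((a / y + inverse y) / 2) = (a * (a + 1) / 2) / (y * y)" for a y :: real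
      by (cases "y = 0") (simp_all add: field_simps)
    from this[of "?A d" "real d ^ m"] show ?thesis
      by (simp only: power_inverse mult_2 power_add)
  qed
  moreover have limit: "1 / fact m * ((1 / fact m + 0 ^ m) / 2) = 1 / (2 * (fact m)\<^sup>2 :: real)"
    using assms(1) by (simp add: power2_eq_square zero_power)
  ultimately have lower: "(\<lambda>d. (?A d * (?A d + 1) / 2) / real d ^ (2 * m)) \<longlonglongrightarrow> 1 / (2 * (fact m)\<^sup>2)"
    by (simp only: limit)
  have "(\<lambda>d. real ((d - k + 2 * m) choose (2 * m)) / real d ^ (2 * m)) \<longlonglongrightarrow> 1 / fact (2 * m)" for k
  proof -
    have "(\<lambda>d. real ((d - k + 2 * m) choose (2 * m)) / real (d - k) ^ (2 * m)) \<longlonglongrightarrow> 1 / fact (2 * m)"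
      by (rule filterlim_compose[OF tendsto_binomial_over_power filterlim_minus_const_nat_at_top])
    moreover have "(\<lambda>d. (real (d - k) / real d) ^ (2 * m)) \<longlonglongrightarrow> 1 ^ (2 * m)"
    proof (intro tendsto_power)
      have "(\<lambda>d. (real d - real k) / real d) \<longlonglongrightarrow> 1"
        using tendsto_shifted_ratio[of "- real k"] by simp
      moreover have "\<forall>\<^sub>F d in sequentially. (real d - real k) / real d = real (d - k) / real d"
        using eventually_ge_at_top[of k] by eventually_elim (simp add: of_nat_diff)
      ultimately show "(\<lambda>d. real (d - k) / real d) \<longlonglongrightarrow> 1" by (rule Lim_transform_eventually)
    qed
    ultimately have "(\<lambda>d. real ((d - k + 2 * m) choose (2 * m)) / real (d - k) ^ (2 * m) *
        (real (d - k) / real d) ^ (2 * m)) \<longlonglongrightarrow> 1 / fact (2 * m) * 1 ^ (2 * m)"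
      by (rule tendsto_mult)
    then have "(\<lambda>d. real ((d - k + 2 * m) choose (2 * m)) / real (d - k) ^ (2 * m) *
        (real (d - k) / real d) ^ (2 * m)) \<longlonglongrightarrow> 1 / fact (2 * m)" by simp
    moreover have "\<forall>\<^sub>F d in sequentially. real ((d - k + 2 * m) choose (2 * m)) / real (d - k) ^ (2 * m) *
        (real (d - k) / real d) ^ (2 * m) = real ((d - k + 2 * m) choose (2 * m)) / real d ^ (2 * m)"
      using eventually_gt_at_top[of k] by eventually_elim (simp add: power_divide)
    ultimately show ?thesis by (rule Lim_transform_eventually)
  qed
  then have "(\<lambda>d. \<Sum>k\<le>N. real ((d - k + 2 * m) choose (2 * m)) / real d ^ (2 * m))
      \<longlonglongrightarrow> (\<Sum>k\<le>N. 1 / fact (2 * m))"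
    by (intro tendsto_sum)
  then have upper: "(\<lambda>d. real (\<Sum>k\<le>N. (d - k + 2 * m) choose (2 * m)) / real d ^ (2 * m))
      \<longlonglongrightarrow> real (N + 1) / fact (2 * m)"
    by (simp add: sum_divide_distrib)
  have "1 / (2 * (fact m)\<^sup>2) < real (N + 1) / fact (2 * m)"
  proof -
    have "real (2 * m choose m) = fact (2 * m) / (fact m)\<^sup>2"
      by (subst binomial_fact) (simp_all add: power2_eq_square mult_2)
    then have "1 / (2 * (fact m)\<^sup>2) = (real (2 * m choose m) / 2) / fact (2 * m)" by simp
    moreover have "real (2 * m choose m) / 2 < real (N + 1)" unfolding N_def by linarith
    ultimately show ?thesis by (simp only: divide_strict_right_mono fact_gt_zero)
  qed
  then obtain y where y: "1 / (2 * (fact m)\<^sup>2) < y" "y < real (N + 1) / fact (2 * m)"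
    using dense by blast
  have "\<forall>\<^sub>F d in sequentially. (?A d * (?A d + 1) / 2) / real d ^ (2 * m) < y"
    using order_tendstoD(2)[OF lower y(1)] .
  moreover have "\<forall>\<^sub>F d in sequentially. y < real (\<Sum>k\<le>N. (d - k + 2 * m) choose (2 * m)) / real d ^ (2 * m)"
    using order_tendstoD(1)[OF upper y(2)] .
  moreover have "\<forall>\<^sub>F d in sequentially. d \<ge> Suc N" by (rule eventually_ge_at_top)
  ultimately have "\<forall>\<^sub>F d in sequentially. d \<ge> Suc N \<and> (?A d * (?A d + 1) / 2) / real d ^ (2 * m) <
      real (\<Sum>k\<le>N. (d - k + 2 * m) choose (2 * m)) / real d ^ (2 * m)"
    by eventually_elim auto
  then obtain d where d: "d \<ge> Suc N" and "(?A d * (?A d + 1) / 2) / real d ^ (2 * m) <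
      real (\<Sum>k\<le>N. (d - k + 2 * m) choose (2 * m)) / real d ^ (2 * m)"
    using eventually_happens[of _ sequentially] trivial_limit_sequentially by blast
  then have lt: "?A d * (?A d + 1) / 2 < real (\<Sum>k\<le>N. (d - k + 2 * m) choose (2 * m))"
    by (subst (asm) divide_less_cancel) auto
  let ?B = "(d + m) choose m"
  have "real ((?B * (?B + 1)) div 2) \<le> real (?B * (?B + 1)) / 2" by linarith
  also have "\<dots> = ?A d * (?A d + 1) / 2" by (simp add: algebra_simps)
  finally have "real ((?B * (?B + 1)) div 2) < real (\<Sum>k\<le>N. (d - k + 2 * m) choose (2 * m))"
    using lt by linarith
  then show ?thesis using d of_nat_less_iff Suc_leD by blast
qed

section \<open>Values of a form on a generic fibre\<close>

text \<open>All products \<open>f\<^sup>\<alpha> * g ^ k\<close> of total degree \<open>d\<close> with \<open>k \<le> N\<close> are forms of degree \<open>d\<close>. For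
  suitable \<open>d\<close> there are more of them than hermitian monomials of degree \<open>d\<close>, so they are linearly
  dependent. Bounding the exponent of \<open>g\<close> by \<open>N\<close> makes the relation a polynomial of degree at most
  \<open>N\<close> in \<open>g\<close>.\<close>

lemma polynomial_relation_exists:
  fixes z :: "'x \<Rightarrow> 'v \<Rightarrow> complex" and f :: "'e \<Rightarrow> 'x \<Rightarrow> real"
  assumes "m \<ge> 1" "finite V" "card V = m + 1" "finite E" "card E = 2 * m + 1"
    and f: "\<And>e. e \<in> E \<Longrightarrow> f e \<in> hermitian_forms z V 1"
    and g: "g \<in> hermitian_forms z V 1"
  shows "\<exists>d c. (\<exists>k\<le>(2 * m choose m) div 2. \<exists>\<alpha>\<in>multi_indices E (d - k). c k \<alpha> \<noteq> 0) \<and>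
    (\<forall>x. (\<Sum>k\<le>(2 * m choose m) div 2.
      (\<Sum>\<alpha>\<in>multi_indices E (d - k). c k \<alpha> * monomial_value \<alpha> (\<lambda>e. f e x)) * g x ^ k) = 0)"
proof -
  define N where "N = (2 * m choose m) div 2"
  obtain d where d: "d \<ge> N" "(((d + m) choose m) * (((d + m) choose m) + 1)) div 2 <
      (\<Sum>k\<le>N. (d - k + 2 * m) choose (2 * m))"
    using enough_monomials[OF assms(1)] unfolding N_def by blast
  let ?I = "SIGMA k:{..N}. multi_indices E (d - k)"
  let ?F = "\<lambda>(k, \<alpha>) x. monomial_value \<alpha> (\<lambda>e. f e x) * g x ^ k"
  have "card (hermitian_monomials z V d) \<le> (((d + m) choose m) * (((d + m) choose m) + 1)) div 2"
    using card_hermitian_monomials[OF assms(2) refl, of z d] binomial_symmetric[of d "d + m"] assms(3)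
    by simp
  also note d(2)
  also have "(\<Sum>k\<le>N. (d - k + 2 * m) choose (2 * m)) = card ?I"
  proof -
    have "(d - k + 2 * m) choose (2 * m) = card (multi_indices E (d - k))" for k
      using binomial_symmetric[of "d - k" "d - k + 2 * m"] assms(4,5) by (simp add: card_multi_indices)
    then show ?thesis using assms(4) by simp
  qed
  finally have "card (hermitian_monomials z V d) < card ?I" .
  moreover have "?F i \<in> hermitian_forms z V d" if i: "i \<in> ?I" for i
  proof -
    obtain k \<alpha> where i': "i = (k, \<alpha>)" "k \<le> N" "\<alpha> \<in> multi_indices E (d - k)" using i by auto
    have "(\<lambda>x. monomial_value \<alpha> (\<lambda>e. f e x) * g x ^ k) \<in> hermitian_forms z V ((d - k) + 1 * k)"
      by (intro hermitian_forms_mult hermitian_forms_monomial_value[OF assms(2,4)]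
          hermitian_forms_power f g assms(2) i'(3))
    then show ?thesis using i'(1,2) d(1) by simp
  qed
  moreover have "finite ?I" using assms(4) by simp
  ultimately have "\<exists>c. (\<exists>i\<in>?I. c i \<noteq> 0) \<and> (\<forall>x. (\<Sum>i\<in>?I. c i * ?F i x) = 0)"
    by (intro linear_relation_exists[OF finite_hermitian_monomials[OF assms(2)]])
  then obtain c where c: "\<exists>i\<in>?I. c i \<noteq> 0" "\<And>x. (\<Sum>i\<in>?I. c i * ?F i x) = 0"
    by blast
  show ?thesis unfolding N_def[symmetric]
  proof (rule exI[of _ d], rule exI[of _ "\<lambda>k \<alpha>. c (k, \<alpha>)"], rule conjI[OF _ allI])
    show "\<exists>k\<le>N. \<exists>\<alpha>\<in>multi_indices E (d - k). c (k, \<alpha>) \<noteq> 0" using c(1) by auto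
    fix x
    have "(\<Sum>i\<in>?I. c i * ?F i x) = (\<Sum>(k, \<alpha>)\<in>?I. c (k, \<alpha>) * (monomial_value \<alpha> (\<lambda>e. f e x) * g x ^ k))"
      by (rule sum.cong) auto
    also have "\<dots> = (\<Sum>k\<le>N. \<Sum>\<alpha>\<in>multi_indices E (d - k).
        c (k, \<alpha>) * (monomial_value \<alpha> (\<lambda>e. f e x) * g x ^ k))"
      using assms(4) by (subst sum.Sigma) auto
    also have "\<dots> = (\<Sum>k\<le>N. (\<Sum>\<alpha>\<in>multi_indices E (d - k).
        c (k, \<alpha>) * monomial_value \<alpha> (\<lambda>e. f e x)) * g x ^ k)"
      by (simp add: sum_distrib_right mult.assoc)
    finally show "(\<Sum>k\<le>N. (\<Sum>\<alpha>\<in>multi_indices E (d - k).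
        c (k, \<alpha>) * monomial_value \<alpha> (\<lambda>e. f e x)) * g x ^ k) = 0"
      using c(2)[of x] by simp
  qed
qed

text \<open>On the fibre over \<open>\<sigma>\<close> the coefficients of the relation become constants, so the values of \<open>g\<close>
  are roots of one polynomial of degree at most \<open>N\<close>. It is nonzero as soon as \<open>\<sigma>\<close> avoids the
  zeros of a single coefficient polynomial \<open>P \<noteq> 0\<close>. The argument also covers algebraically
  dependent \<open>f\<close>: the relation may then be free of \<open>g\<close>, and a nonzero constant has no roots,
  which says that the generic fibre is empty.\<close>

lemma generic_fibre_values_bound:
  fixes z :: "'x \<Rightarrow> 'v \<Rightarrow> complex"
  assumes "m \<ge> 1" "finite V" "card V = m + 1" "finite E" "card E = 2 * m + 1"
    and "\<And>e. e \<in> E \<Longrightarrow> f e \<in> hermitian_forms z V 1"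
    and "g \<in> hermitian_forms z V 1"
  shows "for_generic_assignment E (\<lambda>\<sigma>. finite (g ` {x. \<forall>e\<in>E. f e x = \<sigma> e}) \<and>
    card (g ` {x. \<forall>e\<in>E. f e x = \<sigma> e}) \<le> (2 * m choose m) div 2)"
proof -
  define N where "N = (2 * m choose m) div 2"
  obtain d c k0 \<alpha>0 where k0: "k0 \<le> N" "\<alpha>0 \<in> multi_indices E (d - k0)" "c k0 \<alpha>0 \<noteq> (0::real)"
    and rel: "\<And>x. (\<Sum>k\<le>N. (\<Sum>\<alpha>\<in>multi_indices E (d - k).
      c k \<alpha> * monomial_value \<alpha> (\<lambda>e. f e x)) * g x ^ k) = 0"
    using polynomial_relation_exists[of m V E f z g] assms unfolding N_def by blast
  define P where "P = (\<Sum>\<alpha>\<in>multi_indices E (d - k0). Poly_Mapping.single \<alpha> (c k0 \<alpha>))"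
  have "Poly_Mapping.lookup P \<alpha>0 = c k0 \<alpha>0"
    using k0 assms(4) by (simp add: P_def lookup_sum lookup_single when_def)
  then have "P \<noteq> 0" using k0 by auto
  moreover have "mpoly_vars P \<subseteq> E"
    using keys_sum[of "\<lambda>\<alpha>. Poly_Mapping.single \<alpha> (c k0 \<alpha>)" "multi_indices E (d - k0)"]
    unfolding mpoly_vars_def P_def by (fastforce simp: multi_indices_def split: if_splits)
  ultimately have "for_generic_assignment E (\<lambda>\<sigma>. mpoly_eval P \<sigma> \<noteq> 0)"
    using for_generic_assignment_nonvanishing[OF assms(4)] by blast
  then show ?thesis
  proof (rule for_generic_assignment_mono)
    fix \<sigma> assume nz: "mpoly_eval P \<sigma> \<noteq> 0"
    let ?a = "\<lambda>k. \<Sum>\<alpha>\<in>multi_indices E (d - k). c k \<alpha> * monomial_value \<alpha> \<sigma>"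
    define q where "q = (\<Sum>k\<le>N. monom (?a k) k)"
    have "coeff q k0 = mpoly_eval P \<sigma>"
      using k0(1) by (simp add: q_def coeff_sum P_def mpoly_eval_sum mpoly_eval_single)
    then have q0: "q \<noteq> 0" using nz by auto
    have deg: "degree q \<le> N" unfolding q_def
      by (intro degree_sum_le order.trans[OF degree_monom_le]) auto
    have "g ` {x. \<forall>e\<in>E. f e x = \<sigma> e} \<subseteq> {t. poly q t = 0}"
    proof clarify
      fix x assume x: "\<forall>e\<in>E. f e x = \<sigma> e"
      have "monomial_value \<alpha> (\<lambda>e. f e x) = monomial_value \<alpha> \<sigma>" if "\<alpha> \<in> multi_indices E i" for i \<alpha>
        unfolding monomial_value_def using that x
        by (intro prod.cong) (auto simp: multi_indices_def)
      then have "poly q (g x) = (\<Sum>k\<le>N. (\<Sum>\<alpha>\<in>multi_indices E (d - k).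
          c k \<alpha> * monomial_value \<alpha> (\<lambda>e. f e x)) * g x ^ k)"
        by (simp add: q_def poly_sum poly_monom)
      then show "poly q (g x) = 0" using rel by simp
    qed
    note sub = this
    have fin: "finite {t. poly q t = 0}" by (rule poly_roots_finite[OF q0])
    have "card {t. poly q t = 0} \<le> N" using card_poly_roots_bound[OF q0] deg by simp
    then show "finite (g ` {x. \<forall>e\<in>E. f e x = \<sigma> e}) \<and>
        card (g ` {x. \<forall>e\<in>E. f e x = \<sigma> e}) \<le> (2 * m choose m) div 2"
      unfolding N_def[symmetric]
      using finite_subset[OF sub fin] card_mono[OF fin sub] by simp
  qed
qed

section \<open>Squared distances and congruence\<close>

text \<open>The plane is identified with the complex numbers, where rotations are multiplications.\<close>

definition complex_of_vec :: "real^2 \<Rightarrow> complex" where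
  "complex_of_vec v = Complex (v $ 1) (v $ 2)"

definition vec_of_complex :: "complex \<Rightarrow> real^2" where
  "vec_of_complex w = vector [Re w, Im w]"

lemma vec_of_complex_inverse [simp]: "complex_of_vec (vec_of_complex w) = w"
  by (simp add: complex_of_vec_def vec_of_complex_def)

lemma complex_of_vec_inverse [simp]: "vec_of_complex (complex_of_vec v) = v"
  by (simp add: complex_of_vec_def vec_of_complex_def vec_eq_iff forall_2)

lemma complex_of_vec_diff: "complex_of_vec (v - w) = complex_of_vec v - complex_of_vec w"
  by (simp add: complex_of_vec_def complex_eq_iff)

lemma norm_complex_of_vec [simp]: "norm (complex_of_vec v) = norm v"
  by (simp add: complex_of_vec_def norm_vec_def L2_set_def sum_2 cmod_def)

lemma dist_complex_of_vec: "dist (complex_of_vec v) (complex_of_vec w) = dist v w"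
  by (simp add: dist_norm complex_of_vec_diff[symmetric])

lemma dist_vec_of_complex: "dist (vec_of_complex u) (vec_of_complex w) = dist u w"
  using dist_complex_of_vec[of "vec_of_complex u" "vec_of_complex w"] by simp

definition relative_position :: "(nat \<Rightarrow> real^2) \<Rightarrow> nat \<Rightarrow> complex" where
  "relative_position p i = complex_of_vec (p i) - complex_of_vec (p 1)"

lemma norm_diff_relative_position:
  "norm (p i - p j) = cmod (relative_position p i - relative_position p j)"
  by (simp add: relative_position_def complex_of_vec_diff[symmetric])

lemma Re_mult_cnj_self: "Re (u * cnj u) = (cmod u)\<^sup>2"
  by (simp only: cmod_power2) (simp add: power2_eq_square)

lemma cmod_diff_squared:
  "(cmod (u - v))\<^sup>2 = (cmod u)\<^sup>2 + (cmod v)\<^sup>2 - 2 * Re (u * cnj v)"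
  by (simp add: cmod_power2 power2_diff algebra_simps)

text \<open>Translations are removed by measuring positions from the first point, which leaves the \<open>n - 1\<close>
  coordinates with indices \<open>2..n\<close>; inner products that involve the first point vanish.\<close>

lemma squared_distance_hermitian_form:
  assumes "i \<in> {1..n}" "j \<in> {1..n}"
  shows "(\<lambda>p. (norm (p i - p j))\<^sup>2) \<in> hermitian_forms relative_position {2..n} 1"
proof -
  let ?r = relative_position
  have ip: "(\<lambda>p. Re (?r p i * cnj (?r p j))) \<in> hermitian_forms ?r {2..n} 1"
    if ij: "i \<in> {1..n}" "j \<in> {1..n}" for i j
  proof (cases "i = 1 \<or> j = 1")
    case True
    then have "(\<lambda>p. Re (?r p i * cnj (?r p j))) = 0"
      by (auto simp: relative_position_def fun_eq_iff)
    then show ?thesis using real_fun.span_zero by simp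
  next
    case False
    then have mi: "Poly_Mapping.single i (1::nat) \<in> multi_indices {2..n} 1"
      "Poly_Mapping.single j (1::nat) \<in> multi_indices {2..n} 1"
      using ij by (auto simp: multi_indices_def lookup_single when_def)
    have "(\<lambda>p. Re (?r p i * cnj (?r p j))) \<in> hermitian_monomials ?r {2..n} 1"
      unfolding hermitian_monomials_def
      by (rule CollectI, rule exI[of _ "Poly_Mapping.single i 1"],
          rule exI[of _ "Poly_Mapping.single j 1"])
        (use mi in \<open>simp add: monomial_value_single[unfolded One_nat_def]\<close>)
    then show ?thesis by (rule real_fun.span_base)
  qed
  have "(\<lambda>p. Re (?r p i * cnj (?r p i))) + (\<lambda>p. Re (?r p j * cnj (?r p j))) +
      (\<lambda>p. (-2) * Re (?r p i * cnj (?r p j))) \<in> hermitian_forms ?r {2..n} 1"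
    by (intro real_fun.span_add real_fun.span_scale ip assms)
  also have "(\<lambda>p. Re (?r p i * cnj (?r p i))) + (\<lambda>p. Re (?r p j * cnj (?r p j))) +
      (\<lambda>p. (-2) * Re (?r p i * cnj (?r p j))) = (\<lambda>p. (norm (p i - p j))\<^sup>2)"
    unfolding norm_diff_relative_position cmod_diff_squared Re_mult_cnj_self
    by (simp add: fun_eq_iff)
  finally show ?thesis .
qed

lemma plane_isometryI:
  assumes "cmod a = 1" "c = id \<or> c = cnj"
  shows "plane_isometry (\<lambda>v. vec_of_complex (a * c (complex_of_vec v - u) + w))"
    (is "plane_isometry ?f")
  unfolding plane_isometry_def
proof (intro conjI allI)
  show d: "dist (?f x) (?f y) = dist x y" for x y
  proof -
    have "dist (?f x) (?f y) = cmod (a * (c (complex_of_vec x - u) - c (complex_of_vec y - u)))"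
      unfolding dist_vec_of_complex by (simp add: dist_norm right_diff_distrib)
    also have "\<dots> = cmod (complex_of_vec x - complex_of_vec y)"
      using assms by (auto simp: norm_mult complex_cnj_diff[symmetric] simp del: complex_cnj_diff)
    finally show ?thesis by (simp add: complex_of_vec_diff[symmetric] dist_norm)
  qed
  have "inj ?f"
  proof (rule injI)
    fix x y assume "?f x = ?f y"
    then have "dist x y = 0" using d[of x y] by simp
    then show "x = y" by simp
  qed
  moreover have "surj ?f"
  proof (rule surjI)
    fix v
    let ?x = "vec_of_complex (c ((complex_of_vec v - w) / a) + u)"
    have "a \<noteq> 0" using assms by auto
    then show "?f ?x = v" using assms(2) by auto
  qed
  ultimately show "bij ?f" by (rule bijI)
qed

text \<open>A tuple is determined by its Gram matrix up to a rotation, possibly composed with complex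
  conjugation. Choose \<open>b\<close> with \<open>z b \<noteq> 0\<close> and rotate and scale both tuples so that their entries at
  \<open>b\<close> become real; the new tuples are \<open>Z\<close> and \<open>W\<close>. Inner products with the entry at \<open>b\<close> show
  that the real parts agree, and then all products \<open>Im (Z i) * Im (Z j)\<close> agree with those of \<open>W\<close>,
  so the imaginary parts agree up to one common sign.\<close>

lemma congruent_complex_tuples:
  fixes z w :: "'i \<Rightarrow> complex"
  assumes ip: "\<And>i j. i \<in> I \<Longrightarrow> j \<in> I \<Longrightarrow> Re (z i * cnj (z j)) = Re (w i * cnj (w j))"
  shows "\<exists>a c. cmod a = 1 \<and> (c = id \<or> c = cnj) \<and> (\<forall>i\<in>I. w i = a * c (z i))"
proof (cases "\<forall>i\<in>I. z i = 0")
  case True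
  have "w i = 0" if "i \<in> I" for i
    using ip[OF that that] True that unfolding Re_mult_cnj_self by simp
  then show ?thesis using True by (intro exI[of _ 1] exI[of _ id]) auto
next
  case False
  then obtain b where b: "b \<in> I" "z b \<noteq> 0" by blast
  have norm_eq: "cmod (z i) = cmod (w i)" if "i \<in> I" for i
    using ip[OF that that] unfolding Re_mult_cnj_self by simp
  have wb: "w b \<noteq> 0" using norm_eq[OF b(1)] b(2) by auto
  define Z W where "Z i = cnj (z b) * z i" and "W i = cnj (w b) * w i" for i
  have re: "Re (Z i) = Re (W i)" if "i \<in> I" for i
    using ip[OF that b(1)] by (simp add: Z_def W_def mult.commute)
  have "Re (Z i * cnj (Z j)) = Re (W i * cnj (W j))" if "i \<in> I" "j \<in> I" for i j
  proof -
    have "Z i * cnj (Z j) = (z b * cnj (z b)) * (z i * cnj (z j))" by (simp add: Z_def)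
    then have "Re (Z i * cnj (Z j)) = (cmod (z b))\<^sup>2 * Re (z i * cnj (z j))"
      by (simp only: complex_norm_square[symmetric] scaleR_conv_of_real[symmetric] scaleR_complex.sel)
    moreover have "W i * cnj (W j) = (w b * cnj (w b)) * (w i * cnj (w j))" by (simp add: W_def)
    then have "Re (W i * cnj (W j)) = (cmod (w b))\<^sup>2 * Re (w i * cnj (w j))"
      by (simp only: complex_norm_square[symmetric] scaleR_conv_of_real[symmetric] scaleR_complex.sel)
    ultimately show ?thesis using ip[OF that] norm_eq[OF b(1)] by simp
  qed
  then have im: "Im (Z i) * Im (Z j) = Im (W i) * Im (W j)" if "i \<in> I" "j \<in> I" for i j
    using that re by fastforce
  have "(\<forall>i\<in>I. Im (W i) = Im (Z i)) \<or> (\<forall>i\<in>I. Im (W i) = - Im (Z i))"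
  proof (rule disjCI, rule ballI)
    fix i assume i: "i \<in> I" and "\<not> (\<forall>i\<in>I. Im (W i) = - Im (Z i))"
    then obtain j where j: "j \<in> I" "Im (W j) \<noteq> - Im (Z j)" by blast
    have "(Im (W j))\<^sup>2 = (Im (Z j))\<^sup>2" using im[OF j(1) j(1)] by (simp add: power2_eq_square)
    then have eq: "Im (W j) = Im (Z j)" using j(2) by (auto simp: power2_eq_iff)
    then have "Im (Z j) \<noteq> 0" using j(2) by auto
    then show "Im (W i) = Im (Z i)" using im[OF i j(1)] eq by simp
  qed
  then show ?thesis
  proof
    assume *: "\<forall>i\<in>I. Im (W i) = Im (Z i)"
    have "w i = (cnj (z b) / cnj (w b)) * z i" if "i \<in> I" for i
    proof -
      have "W i = Z i" using * re that by (simp add: complex_eq_iff)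
      then show ?thesis using wb by (simp add: W_def Z_def field_simps)
    qed
    then show ?thesis using norm_eq[OF b(1)] wb
      by (intro exI[of _ "cnj (z b) / cnj (w b)"] exI[of _ id]) (auto simp: norm_divide)
  next
    assume *: "\<forall>i\<in>I. Im (W i) = - Im (Z i)"
    have "w i = (z b / cnj (w b)) * cnj (z i)" if "i \<in> I" for i
    proof -
      have "W i = cnj (Z i)" using * re that by (simp add: complex_eq_iff)
      then show ?thesis using wb by (simp add: W_def Z_def field_simps)
    qed
    then show ?thesis using norm_eq[OF b(1)] wb
      by (intro exI[of _ "z b / cnj (w b)"] exI[of _ cnj]) (auto simp: norm_divide)
  qed
qed

lemma congruence_if_equal_distances:
  assumes "n \<ge> 1" "p \<in> configurations n" "q \<in> configurations n"
    and dist: "\<And>i j. i \<in> {1..n} \<Longrightarrow> j \<in> {1..n} \<Longrightarrow> norm (p i - p j) = norm (q i - q j)"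
  shows "(p, q) \<in> congruence n"
proof -
  let ?r = relative_position
  have "Re (?r p i * cnj (?r p j)) = Re (?r q i * cnj (?r q j))" if ij: "i \<in> {1..n}" "j \<in> {1..n}" for i j
  proof -
    have polar: "2 * Re (?r s i * cnj (?r s j)) =
        (norm (s i - s 1))\<^sup>2 + (norm (s j - s 1))\<^sup>2 - (norm (s i - s j))\<^sup>2" for s
      unfolding norm_diff_relative_position[of s i j] cmod_diff_squared
      by (simp add: norm_diff_relative_position relative_position_def)
    have "1 \<in> {1..n}" using assms(1) by simp
    then show ?thesis using polar[of p] polar[of q] dist ij by simp
  qed
  then obtain a c where a: "cmod a = 1" "c = id \<or> c = cnj" "\<forall>i\<in>{1..n}. ?r q i = a * c (?r p i)"
    using congruent_complex_tuples[of "{1..n}" "?r p" "?r q"] by blast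
  let ?f = "\<lambda>v. vec_of_complex (a * c (complex_of_vec v - complex_of_vec (p 1)) + complex_of_vec (q 1))"
  have "q i = ?f (p i)" if "i \<in> {1..n}" for i
  proof -
    have "complex_of_vec (q i) = a * c (?r p i) + complex_of_vec (q 1)"
      using a(3)[rule_format, OF that] by (simp only: relative_position_def[of q] diff_eq_eq)
    then have "vec_of_complex (complex_of_vec (q i)) = ?f (p i)"
      by (simp only: relative_position_def)
    then show ?thesis by simp
  qed
  then show ?thesis
    using assms(2,3) plane_isometryI[OF a(1,2)] unfolding congruence_def by blast
qed

section \<open>Separating congruence classes\<close>

text \<open>For two points of \<open>Y\<close> the difference of the two values is a nonzero polynomial in \<open>t\<close> of
  degree at most \<open>M\<close>, so each pair excludes at most \<open>M\<close> values of \<open>t\<close>. The bound on \<open>t\<close>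
  depends only on the size of \<open>Y\<close>, so one finite set of parameters serves all \<open>Y\<close> of that size.\<close>

lemma separating_combination:
  fixes D :: "'x \<Rightarrow> nat \<Rightarrow> real"
  assumes "finite Y" "\<And>p q. p \<in> Y \<Longrightarrow> q \<in> Y \<Longrightarrow> p \<noteq> q \<Longrightarrow> \<exists>l<M. D p l \<noteq> D q l"
  shows "\<exists>t\<le>card Y * card Y * M. inj_on (\<lambda>p. \<Sum>l<M. D p l * real t ^ l) Y"
proof -
  let ?h = "\<lambda>p q. \<Sum>l<M. monom (D p l - D q l) l"
  let ?Q = "{(p, q). p \<in> Y \<and> q \<in> Y \<and> p \<noteq> q}"
  let ?bad = "\<lambda>(p, q). {t::nat. poly (?h p q) (real t) = 0}"
  have Q: "?Q \<subseteq> Y \<times> Y" by auto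
  then have finQ: "finite ?Q" using assms(1) finite_subset by blast
  have bad: "finite (?bad x) \<and> card (?bad x) \<le> M" if xQ: "x \<in> ?Q" for x
  proof -
    obtain p q where x: "x = (p, q)" "p \<in> Y" "q \<in> Y" "p \<noteq> q" using xQ by auto
    then obtain l where l: "l < M" "D p l \<noteq> D q l" using assms(2) by blast
    have "coeff (?h p q) l = D p l - D q l" using l(1) by (simp add: coeff_sum)
    then have nz: "?h p q \<noteq> 0" using l(2) by auto
    have "degree (?h p q) \<le> M"
      by (intro degree_sum_le order.trans[OF degree_monom_le]) auto
    then have "card {s. poly (?h p q) s = 0} \<le> M" using card_poly_roots_bound[OF nz] by simp
    moreover have sub: "real ` ?bad x \<subseteq> {s. poly (?h p q) s = 0}" using x by auto
    moreover have fin: "finite {s. poly (?h p q) s = 0}" by (rule poly_roots_finite[OF nz])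
    ultimately have "finite (real ` ?bad x) \<and> card (real ` ?bad x) \<le> M"
      using finite_subset[OF sub fin] card_mono[OF fin sub] by simp
    then show ?thesis by (simp add: finite_image_iff card_image)
  qed
  have "card (\<Union>x\<in>?Q. ?bad x) \<le> (\<Sum>x\<in>?Q. card (?bad x))"
    by (rule card_UN_le[OF finQ])
  also have "\<dots> \<le> (\<Sum>x\<in>?Q. M)" using bad by (intro sum_mono) blast
  also have "\<dots> \<le> card Y * card Y * M"
    using card_mono[OF _ Q] assms(1) by (simp add: card_cartesian_product)
  also have "\<dots> < card {..card Y * card Y * M}" by simp
  finally have "\<not> {..card Y * card Y * M} \<subseteq> (\<Union>x\<in>?Q. ?bad x)"
    using bad finQ by (meson card_mono finite_UN_I not_le)
  then obtain t where t: "t \<le> card Y * card Y * M" "t \<notin> (\<Union>x\<in>?Q. ?bad x)" by auto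
  have "inj_on (\<lambda>p. \<Sum>l<M. D p l * real t ^ l) Y"
  proof (rule inj_onI, rule ccontr)
    fix p q assume *: "p \<in> Y" "q \<in> Y" "(\<Sum>l<M. D p l * real t ^ l) = (\<Sum>l<M. D q l * real t ^ l)" "p \<noteq> q"
    then have "poly (?h p q) (real t) = 0"
      by (simp add: poly_sum poly_monom left_diff_distrib sum_subtractf)
    then show False using t(2) * by auto
  qed
  then show ?thesis using t(1) by blast
qed

section \<open>The bound on the number of congruence classes\<close>

theorem proposition9p2:
  fixes n :: nat and E :: "nat set set"
  assumes "n \<ge> 3"
    and "E \<subseteq> [{1..n}]\<^bsup>2\<^esup>"
    and "connected_graph n E"
    and "card E = 2 * n - 3"
    and "\<And>W. W \<subseteq> {1..n} \<Longrightarrow> card W \<ge> 2 \<Longrightarrow> card {e \<in> E. e \<subseteq> W} \<le> 2 * card W - 3"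
  shows "for_generic_assignment E (\<lambda>\<sigma>.
           finite (realizations n E \<sigma> // congruence n) \<and>
           real (card (realizations n E \<sigma> // congruence n))
             \<le> 1 / 2 * real ((2 * n - 4) choose (n - 2)))"
proof -
  define m where "m = n - 2"
  have m: "m \<ge> 1" "card {2..n} = m + 1" "card E = 2 * m + 1" "2 * n - 4 = 2 * m"
    using assms(1,4) by (auto simp: m_def)
  define N where "N = (2 * m choose m) div 2"
  define M where "M = n * n"
  \<comment> \<open>Large enough for \<open>separating_combination\<close> on sets of \<open>N + 1\<close> configurations.\<close>
  define K where "K = Suc N * Suc N * M"
  have "finite E" using assms(2) finite_imp_finite_nsets[of "{1..n}" 2] finite_subset by blast
  have edge: "\<exists>i j. i \<in> {1..n} \<and> j \<in> {1..n} \<and> e = {i, j} \<and> Min e = i \<and> Max e = j" if "e \<in> E" for e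
  proof -
    have "e \<subseteq> {1..n}" "card e = 2" "finite e" using assms(2) that by (auto simp: nsets_def)
    then obtain i j where "e = {i, j}" "i < j" by (auto simp: card_2_iff) (metis insert_commute linorder_neqE_nat)
    then show ?thesis using \<open>e \<subseteq> {1..n}\<close> by (intro exI[of _ i] exI[of _ j]) auto
  qed
  let ?f = "\<lambda>e (p :: nat \<Rightarrow> real^2). (norm (p (Min e) - p (Max e)))\<^sup>2"
  \<comment> \<open>The numbers \<open>l < n * n\<close> encode the pairs of vertices, shifted by one because the vertices start
    at \<open>1\<close>.\<close>
  let ?D = "\<lambda>(p :: nat \<Rightarrow> real^2) l. (norm (p (Suc (l div n)) - p (Suc (l mod n))))\<^sup>2"
  let ?g = "\<lambda>t p. \<Sum>l<M. ?D p l * real t ^ l"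
  have f: "?f e \<in> hermitian_forms relative_position {2..n} 1" if e: "e \<in> E" for e
  proof -
    obtain i j where "i \<in> {1..n}" "j \<in> {1..n}" "Min e = i" "Max e = j" using edge[OF e] by blast
    then show ?thesis using squared_distance_hermitian_form by simp
  qed
  have g: "?g t \<in> hermitian_forms relative_position {2..n} 1" for t
  proof -
    have "(\<Sum>l<M. (\<lambda>p. real t ^ l * ?D p l)) \<in> hermitian_forms relative_position {2..n} 1"
    proof (intro real_fun.span_sum real_fun.span_scale squared_distance_hermitian_form)
      fix l assume "l \<in> {..<M}"
      then show "Suc (l div n) \<in> {1..n}" "Suc (l mod n) \<in> {1..n}"
        using assms(1) by (auto simp: M_def less_mult_imp_div_less Suc_le_eq)
    qed
    also have "(\<Sum>l<M. (\<lambda>p. real t ^ l * ?D p l)) = ?g t"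
      by (simp add: fun_eq_iff sum_fun_apply mult.commute)
    finally show ?thesis .
  qed
  have "for_generic_assignment E (\<lambda>\<sigma>. \<forall>t\<in>{..K}. finite (?g t ` {p. \<forall>e\<in>E. ?f e p = \<sigma> e}) \<and>
      card (?g t ` {p. \<forall>e\<in>E. ?f e p = \<sigma> e}) \<le> N)"
    unfolding N_def
    by (intro for_generic_assignment_finite_Ball generic_fibre_values_bound[where z = relative_position, OF m(1) _ m(2) \<open>finite E\<close> m(3)]
        f g) auto
  then show ?thesis
  proof (rule for_generic_assignment_mono)
    fix \<sigma> assume gen: "\<forall>t\<in>{..K}. finite (?g t ` {p. \<forall>e\<in>E. ?f e p = \<sigma> e}) \<and>
      card (?g t ` {p. \<forall>e\<in>E. ?f e p = \<sigma> e}) \<le> N"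
    let ?C = "realizations n E \<sigma> // congruence n"
    have "finite ?C \<and> card ?C \<le> N"
    proof (rule ccontr)
      assume "\<not> ?thesis"
      then obtain C where C: "C \<subseteq> ?C" "card C = Suc N" "finite C"
        by (metis card.infinite infinite_arbitrarily_large not_less_eq_eq obtain_subset_with_card_n nat.distinct(1))
      have "\<exists>p. p \<in> realizations n E \<sigma> \<and> X = congruence n `` {p}" if "X \<in> C" for X
        using that C(1) by (auto simp: quotient_def)
      then obtain r where r: "\<And>X. X \<in> C \<Longrightarrow> r X \<in> realizations n E \<sigma>"
          "\<And>X. X \<in> C \<Longrightarrow> X = congruence n `` {r X}"
        by metis
      let ?Y = "r ` C"
      have "inj_on r C" using r(2) by (metis inj_onI)
      then have Y: "card ?Y = Suc N" "finite ?Y" using C by (auto simp: card_image)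
      have conf: "p \<in> configurations n" if "p \<in> ?Y" for p
        using that r(1) by (auto simp: realizations_def)
      have "\<exists>l<M. ?D p l \<noteq> ?D q l" if pq: "p \<in> ?Y" "q \<in> ?Y" "p \<noteq> q" for p q
      proof (rule ccontr)
        assume eq: "\<not> ?thesis"
        have "norm (p i - p j) = norm (q i - q j)" if ij: "i \<in> {1..n}" "j \<in> {1..n}" for i j
        proof -
          let ?l = "(i - 1) * n + (j - 1)"
          have "?l < M"
          proof -
            have "?l < (i - 1) * n + n" using ij by auto
            also have "\<dots> = i * n" using ij by (cases i) auto
            also have "\<dots> \<le> M" using ij by (simp add: M_def)
            finally show ?thesis .
          qed
          then have "?D p ?l = ?D q ?l" using eq by blast
          moreover have "Suc (?l div n) = i" "Suc (?l mod n) = j"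
            using ij by (cases i; cases j; simp)+
          ultimately have "(norm (p i - p j))\<^sup>2 = (norm (q i - q j))\<^sup>2" by (simp only:)
          then show ?thesis by simp
        qed
        then have "(p, q) \<in> congruence n"
          using assms(1) pq conf by (intro congruence_if_equal_distances) auto
        then have "congruence n `` {p} = congruence n `` {q}"
          by (rule equiv_class_eq[OF equiv_congruence])
        then show False using pq r(2) by (metis imageE)
      qed
      then obtain t where t: "t \<le> card ?Y * card ?Y * M" "inj_on (?g t) ?Y"
        using separating_combination[OF Y(2), of M ?D] by blast
      have "?f e p = \<sigma> e" if "p \<in> ?Y" "e \<in> E" for e p
        using that r(1) edge[OF that(2)] by (auto simp: realizations_def)
      then have "?g t ` ?Y \<subseteq> ?g t ` {p. \<forall>e\<in>E. ?f e p = \<sigma> e}" by blast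
      moreover have "t \<in> {..K}" using t(1) Y(1) by (simp add: K_def)
      ultimately have "card (?g t ` ?Y) \<le> N"
        using gen by (meson card_mono order_trans)
      then show False using card_image[OF t(2)] Y(1) by simp
    qed
    moreover have "real N \<le> 1 / 2 * real ((2 * n - 4) choose (n - 2))"
      unfolding N_def m(4) m_def[symmetric] by linarith
    ultimately show "finite ?C \<and> real (card ?C) \<le> 1 / 2 * real ((2 * n - 4) choose (n - 2))"
      by linarith
  qed
qed

end
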